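(* Algorithm VT$'$ is $c^*(\mathcal{P})$-competitive: for every $T\ge1$ and every sequence $(V_1,\ldots,V_T)\in\{r^{(0)},\ldots,r^{(m)}\}^T$, $\mathbb{E}[\mathsf{ALG}(V_1,\ldots,V_T)]\ge c^*(\mathcal{P})\,\mathsf{OPT}(V_1,\ldots,V_T)$.
   Context: Setting (single-item dynamic pricing, public pricing, deterministic valuations). Fix $m\ge1$, prices $0<r^{(1)}<\cdots<r^{(m)}$, $\mathcal{P}=\{r^{(1)},\ldots,r^{(m)}\}$, $r^{(0)}=0$, $r^{(m+1)}=\infty$, inventory $k\ge1$. Customers $t=1,\ldots,T$ ($T$ unknown) have valuations $V_t\in\{r^{(0)},\ldots,r^{(m)}\}$; an online algorithm chooses a (possibly random) price $P_t\in\{r^{(1)},\ldots,r^{(m+1)}\}$ using only past prices and valuations, and must set $P_t=\infty$ if no inventory remains; $X_t=\mathbb{1}(V_t\ge P_t)$; $\mathsf{ALG}=\sum_tP_tX_t$; $I_t=k-\sum_{t'\le t}X_{t'}$. $\mathsf{OPT}(V_1,\ldots,V_T)$ is the sum of the $\min\{k,T\}$ largest valuations. Let $q^{(j)}=1-r^{(j-1)}/r^{(j)}$, $q=\sum_jq^{(j)}$, $c^*(\mathcal{P})=1/q$. Algorithm VT: initialize $\mathtt{level}[i]=0$, $\mathtt{sold}[i]=\mathtt{false}$ for $i=1,\ldots,k$. For each customer $t$: let $i^*_t$ minimize $\mathtt{level}[i]$ (fixed deterministic tie-breaking), and $\ell_t$ satisfy $\mathtt{level}[i^*_t]=r^{(\ell_t)}$.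 If $\mathtt{sold}[i^*_t]=\mathtt{false}$, choose price $r^{(j)}$, $j\in\{\ell_t+1,\ldots,m\}$, w.p. $q^{(j)}/\sum_{j'=\ell_t+1}^mq^{(j')}$; else price $\infty$. Then observe $V_t,X_t$, set $\mathtt{level}[i^*_t]=\max\{\mathtt{level}[i^*_t],V_t\}$, and if $X_t=1$ set $\mathtt{sold}[i^*_t]=\mathtt{true}$. Algorithm VT$'$: at time $t$, with its own remaining inventory $I_{t-1}$, compute $i^*_t,\ell_t$ as in Algorithm VT from $V_1,\ldots,V_{t-1}$; let $\gamma_t$ be the probability that $\mathtt{sold}[i^*_t]=\mathtt{true}$ in a run of Algorithm VT conditioned on that run having $I_{t-1}$ units remaining at the end of time $t-1$. With probability $1-\gamma_t$ offer a price drawn from the distribution Algorithm VT uses when $\mathtt{sold}[i^*_t]=\mathtt{false}$; with probability $\gamma_t$ offer $\infty$. *)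

theory Defs
  imports "HOL-Probability.Probability"
begin

text \<open>
  The finite prices are \<open>r 1 < \<dots> < r m\<close>, with \<open>r 0 = 0\<close>; the price \<open>r (m + 1) = \<infinity>\<close> is the
  extended real \<open>\<infinity>\<close>, so offered prices have type \<^typ>\<open>ereal\<close>. Valuations are listed in order of
  arrival, and a list of past prices is aligned with the list of past valuations.
\<close>

definition val_set :: "nat \<Rightarrow> (nat \<Rightarrow> real) \<Rightarrow> real set" where
  "val_set m r = r ` {0..m}"

definition price_set :: "nat \<Rightarrow> (nat \<Rightarrow> real) \<Rightarrow> ereal set" where
  "price_set m r = insert \<infinity> ((\<lambda>j. ereal (r j)) ` {1..m})"

definition qj :: "(nat \<Rightarrow> real) \<Rightarrow> nat \<Rightarrow> real" where
  "qj r j = 1 - r (j - 1) / r j"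

definition c_star :: "nat \<Rightarrow> (nat \<Rightarrow> real) \<Rightarrow> real" where
  "c_star m r = 1 / (\<Sum>j=1..m. qj r j)"

definition sale :: "ereal \<Rightarrow> real \<Rightarrow> bool" where
  "sale p v \<longleftrightarrow> ereal v \<ge> p"

definition remaining :: "nat \<Rightarrow> ereal list \<Rightarrow> real list \<Rightarrow> int" where
  "remaining k ps vs = int k - (\<Sum>(p, v)\<leftarrow>zip ps vs. of_bool (sale p v))"

text \<open>The revenue is real-valued because a sale only takes place at a finite price.\<close>

definition revenue :: "ereal list \<Rightarrow> real list \<Rightarrow> real" where
  "revenue ps vs = (\<Sum>(p, v)\<leftarrow>zip ps vs. if sale p v then real_of_ereal p else 0)"

definition opt :: "nat \<Rightarrow> real list \<Rightarrow> real" where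
  "opt k vs = sum_list (take (min k (length vs)) (rev (sort vs)))"


subsection \<open>Online algorithms\<close>

text \<open>
  A policy maps the past prices and past valuations to the distribution of the next price; it sees
  neither the current valuation nor the horizon.
\<close>

type_synonym policy = "ereal list \<Rightarrow> real list \<Rightarrow> ereal pmf"

primrec run_prices :: "policy \<Rightarrow> real list \<Rightarrow> nat \<Rightarrow> ereal list pmf" where
  "run_prices A vs 0 = return_pmf []"
| "run_prices A vs (Suc t) =
     bind_pmf (run_prices A vs t) (\<lambda>ps. map_pmf (\<lambda>p. ps @ [p]) (A ps (take t vs)))"

definition expected_alg :: "policy \<Rightarrow> real list \<Rightarrow> real" where
  "expected_alg A vs =
     measure_pmf.expectation (run_prices A vs (length vs)) (\<lambda>ps. revenue ps vs)"

text \<open>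
  The constraints on an online algorithm are imposed on the histories that it generates with
  positive probability.
\<close>

definition online_algorithm :: "nat \<Rightarrow> (nat \<Rightarrow> real) \<Rightarrow> nat \<Rightarrow> policy \<Rightarrow> bool" where
  "online_algorithm m r k A \<longleftrightarrow>
     (\<forall>vs ps p. set vs \<subseteq> val_set m r \<longrightarrow> ps \<in> set_pmf (run_prices A vs (length vs)) \<longrightarrow>
        p \<in> set_pmf (A ps vs) \<longrightarrow>
        p \<in> price_set m r \<and> (remaining k ps vs \<le> 0 \<longrightarrow> p = \<infinity>))"

definition competitive :: "nat \<Rightarrow> (nat \<Rightarrow> real) \<Rightarrow> nat \<Rightarrow> real \<Rightarrow> policy \<Rightarrow> bool" where
  "competitive m r k c A \<longleftrightarrow>
     (\<forall>vs. vs \<noteq> [] \<longrightarrow> set vs \<subseteq> val_set m r \<longrightarrow> expected_alg A vs \<ge> c * opt k vs)"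


subsection \<open>Algorithm VT\<close>

text \<open>A tie-breaking rule selects one element of every nonempty set of tied units.\<close>

definition tie_breaking :: "nat \<Rightarrow> (nat set \<Rightarrow> nat) \<Rightarrow> bool" where
  "tie_breaking k tie \<longleftrightarrow> (\<forall>S. S \<noteq> {} \<longrightarrow> S \<subseteq> {1..k} \<longrightarrow> tie S \<in> S)"

definition istar :: "nat \<Rightarrow> (nat set \<Rightarrow> nat) \<Rightarrow> (nat \<Rightarrow> real) \<Rightarrow> nat" where
  "istar k tie L = tie {i \<in> {1..k}. \<forall>i' \<in> {1..k}. L i \<le> L i'}"

definition level_index :: "nat \<Rightarrow> (nat \<Rightarrow> real) \<Rightarrow> real \<Rightarrow> nat" where
  "level_index m r x = (THE l. l \<le> m \<and> x = r l)"

definition update_level :: "nat \<Rightarrow> (nat set \<Rightarrow> nat) \<Rightarrow> (nat \<Rightarrow> real) \<Rightarrow> real \<Rightarrow> (nat \<Rightarrow> real)" where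
  "update_level k tie L v = (let i = istar k tie L in L(i := max (L i) v))"

text \<open>
  For \<open>l < m\<close>, \<open>unsold_price m r l\<close> is the price distribution of an unsold unit at level \<open>r l\<close>.
  For \<open>l = m\<close> there is no such distribution and the value is unspecified; a unit at level \<open>r m\<close> is
  always sold, since every finite price is at most \<open>r m\<close>.
\<close>

definition unsold_price :: "nat \<Rightarrow> (nat \<Rightarrow> real) \<Rightarrow> nat \<Rightarrow> ereal pmf" where
  "unsold_price m r l =
     map_pmf (\<lambda>j. ereal (r j))
       (embed_pmf (\<lambda>j. if j \<in> {l+1..m} then qj r j / (\<Sum>j'=l+1..m. qj r j') else 0))"

record vt_state =
  level :: "nat \<Rightarrow> real"
  sold :: "nat \<Rightarrow> bool"
  prices :: "ereal list"

definition vt_init :: vt_state where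
  "vt_init = \<lparr>level = (\<lambda>_. 0), sold = (\<lambda>_. False), prices = []\<rparr>"

definition vt_step ::
    "nat \<Rightarrow> (nat \<Rightarrow> real) \<Rightarrow> nat \<Rightarrow> (nat set \<Rightarrow> nat) \<Rightarrow> vt_state \<Rightarrow> real \<Rightarrow> vt_state pmf" where
  "vt_step m r k tie s v =
     (let i = istar k tie (level s) in
      map_pmf
        (\<lambda>p. \<lparr>level = update_level k tie (level s) v,
              sold = (if sale p v then (sold s)(i := True) else sold s),
              prices = prices s @ [p]\<rparr>)
        (if sold s i then return_pmf \<infinity>
         else unsold_price m r (level_index m r (level s i))))"

definition vt_run ::
    "nat \<Rightarrow> (nat \<Rightarrow> real) \<Rightarrow> nat \<Rightarrow> (nat set \<Rightarrow> nat) \<Rightarrow> real list \<Rightarrow> vt_state pmf" where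
  "vt_run m r k tie vs =
     foldl (\<lambda>M v. bind_pmf M (\<lambda>s. vt_step m r k tie s v)) (return_pmf vt_init) vs"


subsection \<open>Algorithm VT'\<close>

text \<open>The levels in a run of VT are a deterministic function of the past valuations.\<close>

definition vt_levels :: "nat \<Rightarrow> (nat set \<Rightarrow> nat) \<Rightarrow> real list \<Rightarrow> (nat \<Rightarrow> real)" where
  "vt_levels k tie vs = foldl (update_level k tie) (\<lambda>_. 0) vs"

text \<open>
  In \<open>vt_gamma\<close>, \<open>n\<close> is the remaining inventory. If a run of VT never has inventory \<open>n\<close>, the
  conditional probability is \<open>0 / 0 = 0\<close>; this only concerns histories that VT' does not reach.
\<close>

definition vt_gamma ::
    "nat \<Rightarrow> (nat \<Rightarrow> real) \<Rightarrow> nat \<Rightarrow> (nat set \<Rightarrow> nat) \<Rightarrow> real list \<Rightarrow> int \<Rightarrow> real" where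
  "vt_gamma m r k tie vs n =
     \<P>(s in measure_pmf (vt_run m r k tie vs).
         sold s (istar k tie (vt_levels k tie vs)) \<bar> remaining k (prices s) vs = n)"

definition VT' :: "nat \<Rightarrow> (nat \<Rightarrow> real) \<Rightarrow> nat \<Rightarrow> (nat set \<Rightarrow> nat) \<Rightarrow> policy" where
  "VT' m r k tie ps vs =
     (let L = vt_levels k tie vs; l = level_index m r (L (istar k tie L)) in
      bind_pmf (bernoulli_pmf (vt_gamma m r k tie vs (remaining k ps vs)))
        (\<lambda>b. if b then return_pmf \<infinity> else unsold_price m r l))"

end

theory Submission
  imports Defs
begin

text \<open>
  In VT, a unit at level \<open>x\<close> is unsold with probability \<open>(\<Sum>j | x < r j. qj r j) / q\<close>. Since
  \<open>r j * qj r j = r j - r (j - 1)\<close> telescopes, each step earns in expectation the increase of the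
  level of the chosen unit divided by \<open>q\<close>; no independence between units is needed. The levels
  are the \<open>k\<close> largest valuations, so their sum is at least \<open>opt\<close>. VT' draws the status of the
  chosen unit from its conditional law given the inventory, so by induction over the customers the
  pair of inventory and next price has the same law under VT' as under VT. In particular VT' has the
  expected revenue of VT, and it inherits from VT that no price is drawn when nothing is left.
\<close>

section \<open>Sampling from a conditional law\<close>

text \<open>Chain rule: both sides give \<open>(n, b)\<close> the mass of \<open>f = n\<close> times
  the conditional probability of \<open>Q = b\<close>. This is the mechanism of \<open>VT'\<close>,
  with \<open>f\<close> the inventory and \<open>Q\<close> the status of the chosen unit.\<close>

lemma bind_pmf_cond_bernoulli:
  fixes M :: "'a pmf" and f :: "'a \<Rightarrow> 'b" and Q :: "'a \<Rightarrow> bool"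
  shows "map_pmf (\<lambda>s. (f s, Q s)) M =
    bind_pmf (map_pmf f M) (\<lambda>n. map_pmf (Pair n) (bernoulli_pmf (\<P>(s in measure_pmf M. Q s \<bar> f s = n))))"
proof (rule pmf_eqI, clarify)
  fix n :: 'b and b :: bool
  define g where "g n = \<P>(s in measure_pmf M. Q s \<bar> f s = n)" for n
  have g: "g n = measure M {s. Q s \<and> f s = n} / measure M {s. f s = n}" for n
    by (simp add: g_def cond_prob_def)
  have le: "measure M {s. Q s \<and> f s = n} \<le> measure M {s. f s = n}"
    by (intro measure_pmf.finite_measure_mono) auto
  have g01: "0 \<le> g n" "g n \<le> 1"
    using le by (auto simp: g divide_le_eq_1 zero_less_measure_iff)
  have split: "measure M {s. f s = n} = measure M {s. Q s \<and> f s = n} + measure M {s. \<not> Q s \<and> f s = n}"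
    by (subst measure_pmf.finite_measure_Union [symmetric]) (auto intro!: arg_cong [where f = "measure M"])
  have "pmf (map_pmf (Pair n') (bernoulli_pmf (g n'))) (n, b) = indicator {n} n' * pmf (bernoulli_pmf (g n)) b" for n'
  proof (cases "n' = n")
    case True
    then show ?thesis using pmf_map_inj' [of "Pair n" "bernoulli_pmf (g n)" b] by (simp add: inj_def)
  next
    case False
    then show ?thesis by (subst pmf_map_outside) auto
  qed
  then have "pmf (bind_pmf (map_pmf f M) (\<lambda>n. map_pmf (Pair n) (bernoulli_pmf (g n)))) (n, b)
      = pmf (map_pmf f M) n * pmf (bernoulli_pmf (g n)) b"
    by (simp add: pmf_bind measure_pmf_single del: integral_map_pmf)
  also have "\<dots> = measure M {s. f s = n} * (if b then g n else 1 - g n)"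
    using g01 by (simp add: pmf_map vimage_def)
  also have "\<dots> = measure M {s. Q s = b \<and> f s = n}"
  \<comment> \<open>On a null event \<open>g n\<close> is \<open>0 / 0 = 0\<close>, a meaningless
    value that is harmless because its weight is 0.\<close>
  proof (cases "measure M {s. f s = n} = 0")
    case True
    moreover have "measure M {s. Q s = b \<and> f s = n} \<le> measure M {s. f s = n}"
      by (intro measure_pmf.finite_measure_mono) auto
    ultimately show ?thesis using measure_nonneg [of M "{s. Q s = b \<and> f s = n}"] by simp
  next
    case False
    moreover have "measure M {s. \<not> Q s \<and> f s = n} = measure M {s. f s = n} - measure M {s. Q s \<and> f s = n}"
      using split by simp
    ultimately show ?thesis using False by (simp add: g right_diff_distrib)
  qed
  finally show "pmf (map_pmf (\<lambda>s. (f s, Q s)) M) (n, b) =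
    pmf (bind_pmf (map_pmf f M) (\<lambda>n. map_pmf (Pair n) (bernoulli_pmf (\<P>(s in measure_pmf M. Q s \<bar> f s = n))))) (n, b)"
    by (simp add: g_def pmf_map vimage_def conj_commute)
qed

lemma pmf_bind_bool: "pmf (bind_pmf P h) x = pmf P True * pmf (h True) x + pmf P False * pmf (h False) x"
  by (simp add: pmf_bind integral_measure_pmf_real [of UNIV] UNIV_bool)

section \<open>Runs of a policy, one customer at a time\<close>

lemma run_prices_append:
  "t \<le> length vs \<Longrightarrow> run_prices A (vs @ ws) t = run_prices A vs t"
  by (induction t) auto

lemma run_prices_snoc:
  "run_prices A (vs @ [v]) (length (vs @ [v])) =
     bind_pmf (run_prices A vs (length vs)) (\<lambda>ps. map_pmf (\<lambda>p. ps @ [p]) (A ps vs))"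
  by (simp add: run_prices_append)

lemma length_run_prices: "ps \<in> set_pmf (run_prices A vs t) \<Longrightarrow> length ps = t"
  by (induction t arbitrary: ps) auto

lemma remaining_snoc:
  "length ps = length vs \<Longrightarrow> remaining k (ps @ [p]) (vs @ [v]) = remaining k ps vs - of_bool (sale p v)"
  by (simp add: remaining_def)

lemma revenue_snoc:
  "length ps = length vs \<Longrightarrow>
     revenue (ps @ [p]) (vs @ [v]) = revenue ps vs + (if sale p v then real_of_ereal p else 0)"
  by (simp add: revenue_def)

lemma not_sale_infinity [simp]: "\<not> sale \<infinity> v"
  by (simp add: sale_def)

lemma sale_ereal [simp]: "sale (ereal p) v \<longleftrightarrow> p \<le> v"
  by (simp add: sale_def)

text \<open>Reachable histories use prices from a finite set. This supplies integrability of the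
  revenue, since a policy may be arbitrary on unreachable histories.\<close>

lemma finite_run_prices:
  assumes "online_algorithm m r k A" "set vs \<subseteq> val_set m r"
  shows "finite (set_pmf (run_prices A vs (length vs)))"
  using assms(2)
proof (induction vs rule: rev_induct)
  case (snoc v vs)
  have "finite (set_pmf (A ps vs))" if "ps \<in> set_pmf (run_prices A vs (length vs))" for ps
  proof (rule finite_subset)
    show "set_pmf (A ps vs) \<subseteq> price_set m r"
      using assms(1) that snoc.prems unfolding online_algorithm_def by fastforce
  qed (simp add: price_set_def)
  then show ?case
    using snoc by (simp add: run_prices_snoc del: length_append)
qed simp

text \<open>By linearity the expected gain from a customer depends only on the law of the next price
  averaged over histories. So \<open>VT'\<close> can be compared with VT without comparing whole
  histories.\<close>

lemma expected_alg_snoc: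
  assumes "online_algorithm m r k A" "set vs \<subseteq> val_set m r" "v \<in> val_set m r"
  shows "expected_alg A (vs @ [v]) = expected_alg A vs +
    measure_pmf.expectation (bind_pmf (run_prices A vs (length vs)) (\<lambda>ps. A ps vs))
      (\<lambda>p. if sale p v then real_of_ereal p else 0)"
proof -
  define R where "R = run_prices A vs (length vs)"
  define J where "J = bind_pmf R (\<lambda>ps. map_pmf (Pair ps) (A ps vs))"
  have R': "run_prices A (vs @ [v]) (length (vs @ [v])) = map_pmf (\<lambda>(ps, p). ps @ [p]) J"
    unfolding J_def R_def by (subst run_prices_snoc) (simp add: map_bind_pmf pmf.map_comp o_def)
  \<comment> \<open>Appending a price is injective, so finiteness of the support passes from the
    longer run back to \<open>J\<close>.\<close>
  have "inj_on (\<lambda>(ps, p). ps @ [p]) (set_pmf J)" by (auto simp: inj_on_def)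
  moreover have "finite (set_pmf (run_prices A (vs @ [v]) (length (vs @ [v]))))"
    using assms by (intro finite_run_prices) auto
  ultimately have fin: "finite (set_pmf J)"
    unfolding R' set_map_pmf by (rule finite_imageD [rotated])
  have len: "length (fst x) = length vs" if "x \<in> set_pmf J" for x
    using that length_run_prices by (auto simp: J_def R_def)
  have J1: "map_pmf fst J = R"
    by (simp add: J_def map_bind_pmf pmf.map_comp o_def bind_return_pmf')
  have J2: "map_pmf snd J = bind_pmf R (\<lambda>ps. A ps vs)"
    by (simp add: J_def map_bind_pmf pmf.map_comp o_def)
  have "expected_alg A (vs @ [v]) = measure_pmf.expectation J (\<lambda>x. revenue (fst x @ [snd x]) (vs @ [v]))"
    unfolding expected_alg_def R' by (simp add: case_prod_beta)
  also have "\<dots> = measure_pmf.expectation J (\<lambda>x. revenue (fst x) vs +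
      (if sale (snd x) v then real_of_ereal (snd x) else 0))"
    by (intro integral_cong_AE) (auto simp: AE_measure_pmf_iff len revenue_snoc)
  also have "\<dots> = measure_pmf.expectation J (\<lambda>x. revenue (fst x) vs) +
      measure_pmf.expectation J (\<lambda>x. if sale (snd x) v then real_of_ereal (snd x) else 0)"
    by (intro Bochner_Integration.integral_add integrable_measure_pmf_finite fin)
  also have "measure_pmf.expectation J (\<lambda>x. revenue (fst x) vs) = expected_alg A vs"
    unfolding expected_alg_def R_def [symmetric] J1 [symmetric] by simp
  also have "measure_pmf.expectation J (\<lambda>x. if sale (snd x) v then real_of_ereal (snd x) else 0) =
      measure_pmf.expectation (bind_pmf R (\<lambda>ps. A ps vs)) (\<lambda>p. if sale p v then real_of_ereal p else 0)"
    unfolding J2 [symmetric] by simp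
  finally show ?thesis by (simp add: R_def)
qed

section \<open>Unfolding the levels and the runs of VT\<close>

lemma vt_levels_Nil [simp]: "vt_levels k tie [] = (\<lambda>_. 0)"
  by (simp add: vt_levels_def)

lemma vt_levels_snoc: "vt_levels k tie (vs @ [v]) = update_level k tie (vt_levels k tie vs) v"
  by (simp add: vt_levels_def)

lemma vt_run_Nil [simp]: "vt_run m r k tie [] = return_pmf vt_init"
  by (simp add: vt_run_def)

lemma vt_run_snoc: "vt_run m r k tie (vs @ [v]) = bind_pmf (vt_run m r k tie vs) (\<lambda>s. vt_step m r k tie s v)"
  by (simp add: vt_run_def)

lemma level_vt_run: "s \<in> set_pmf (vt_run m r k tie vs) \<Longrightarrow> level s = vt_levels k tie vs"
  by (induction vs arbitrary: s rule: rev_induct)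
    (auto simp: vt_init_def vt_run_snoc vt_step_def vt_levels_snoc Let_def)

lemma length_prices_vt_run: "s \<in> set_pmf (vt_run m r k tie vs) \<Longrightarrow> length (prices s) = length vs"
  by (induction vs arbitrary: s rule: rev_induct)
    (auto simp: vt_init_def vt_run_snoc vt_step_def Let_def)

section \<open>Threshold bound on the offline optimum\<close>

text \<open>Weak duality with unit price \<open>\<theta>\<close>: each of the at most
  \<open>k\<close> selected values is at most \<open>\<theta>\<close> plus its excess, and the
  excesses of the values left out are nonnegative.\<close>

lemma opt_le_threshold:
  assumes "0 \<le> \<theta>"
  shows "opt k vs \<le> real k * \<theta> + (\<Sum>v\<leftarrow>vs. max 0 (v - \<theta>))"
proof -
  define n where "n = min k (length vs)"
  define ws where "ws = rev (sort vs)"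
  have "sum_list xs \<le> real (length xs) * \<theta> + (\<Sum>v\<leftarrow>xs. max 0 (v - \<theta>))" for xs :: "real list"
    by (induction xs) (auto simp: algebra_simps max_def)
  from this [of "take n ws"] have "opt k vs \<le> real n * \<theta> + (\<Sum>v\<leftarrow>take n ws. max 0 (v - \<theta>))"
    by (simp add: opt_def n_def ws_def)
  also have "(\<Sum>v\<leftarrow>take n ws. max 0 (v - \<theta>)) \<le> (\<Sum>v\<leftarrow>take n ws @ drop n ws. max 0 (v - \<theta>))"
    unfolding map_append sum_list_append by (auto intro!: sum_list_nonneg)
  also have "(\<Sum>v\<leftarrow>take n ws @ drop n ws. max 0 (v - \<theta>)) = (\<Sum>v\<leftarrow>vs. max 0 (v - \<theta>))"
  proof -
    have "mset (map (\<lambda>v. max 0 (v - \<theta>)) ws) = mset (map (\<lambda>v. max 0 (v - \<theta>)) vs)"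
      by (simp add: ws_def)
    then show ?thesis by (metis append_take_drop_id sum_mset_sum_list)
  qed
  also have "real n * \<theta> \<le> real k * \<theta>" using assms by (intro mult_right_mono) (auto simp: n_def)
  finally show ?thesis by simp
qed

section \<open>Prices, weights and the chosen unit\<close>

locale vt_pricing =
  fixes m k :: nat and r :: "nat \<Rightarrow> real" and tie :: "nat set \<Rightarrow> nat"
  assumes m1: "m \<ge> 1" and k1: "k \<ge> 1" and r0: "r 0 = 0" and r_mono: "strict_mono_on {0..m} r"
    and tie: "tie_breaking k tie"
begin

abbreviation L :: "real list \<Rightarrow> nat \<Rightarrow> real" where "L vs \<equiv> vt_levels k tie vs"
abbreviation unit :: "real list \<Rightarrow> nat" where "unit vs \<equiv> istar k tie (L vs)"
abbreviation q :: real where "q \<equiv> \<Sum>j=1..m. qj r j"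

text \<open>The unnormalised probability that a unit at level \<open>x\<close> is unsold. The
  argument is a level and not its index, so that \<open>max\<close> of a level and a valuation can
  be inserted directly.\<close>

definition tail :: "real \<Rightarrow> real" where "tail x = (\<Sum>j | j \<in> {1..m} \<and> x < r j. qj r j)"

text \<open>The price kernel shared by both algorithms: VT feeds it the true status of the chosen
  unit, \<open>VT'\<close> a coin with bias \<open>vt_gamma\<close>.\<close>

definition offer :: "real list \<Rightarrow> bool \<Rightarrow> ereal pmf" where
  "offer vs b = (if b then return_pmf \<infinity> else unsold_price m r (level_index m r (L vs (unit vs))))"

lemma r_less_iff: "i \<le> m \<Longrightarrow> j \<le> m \<Longrightarrow> r i < r j \<longleftrightarrow> i < j"
  using strict_mono_on_less [OF r_mono] by simp

lemma r_le_iff: "i \<le> m \<Longrightarrow> j \<le> m \<Longrightarrow> r i \<le> r j \<longleftrightarrow> i \<le> j"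
  using r_less_iff [of j i] by linarith

lemma r_nonneg: "j \<le> m \<Longrightarrow> 0 \<le> r j"
  using r_le_iff [of 0 j] r0 by simp

lemma r_pos: "j \<in> {1..m} \<Longrightarrow> 0 < r j"
  using r_less_iff [of 0 j] r0 by auto

lemma qj_pos: "j \<in> {1..m} \<Longrightarrow> 0 < qj r j"
  using r_less_iff [of "j - 1" j] r_pos [of j] by (auto simp: qj_def)

lemma r_mult_qj: "j \<in> {1..m} \<Longrightarrow> r j * qj r j = r j - r (j - 1)"
  using r_pos [of j] by (simp add: qj_def field_simps)

lemma q_pos: "0 < q"
  using m1 by (intro sum_pos qj_pos) auto

lemma tail_zero: "tail 0 = q"
  using r_pos by (auto simp: tail_def intro!: sum.cong)

lemma tail_r: "l \<le> m \<Longrightarrow> tail (r l) = (\<Sum>j=l+1..m. qj r j)"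
  unfolding tail_def by (intro sum.cong) (auto simp: r_less_iff)

lemma level_index_r: "l \<le> m \<Longrightarrow> level_index m r (r l) = l"
  unfolding level_index_def
  using strict_mono_on_imp_inj_on [OF r_mono] by (intro the_equality) (auto dest: inj_onD)

lemma istar_props:
  shows istar_in: "istar k tie M \<in> {1..k}"
    and istar_le: "i \<in> {1..k} \<Longrightarrow> M (istar k tie M) \<le> M i"
proof -
  define S where "S = {i \<in> {1..k}. \<forall>i' \<in> {1..k}. M i \<le> M i'}"
  have "finite {1..k}" "{1..k} \<noteq> {}" using k1 by auto
  \<comment> \<open>A witness that the set of tied units is nonempty, as the tie-breaking rule
    requires.\<close>
  then have "arg_min_on M {1..k} \<in> S"
    using arg_min_if_finite(1) [of "{1..k}" M] arg_min_least [of "{1..k}" _ M] by (simp add: S_def)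
  moreover have "S \<subseteq> {1..k}" by (auto simp: S_def)
  ultimately have "tie S \<in> S"
    using tie unfolding tie_breaking_def by (metis empty_iff)
  then show "istar k tie M \<in> {1..k}" "i \<in> {1..k} \<Longrightarrow> M (istar k tie M) \<le> M i"
    by (auto simp: istar_def S_def)
qed

section \<open>Levels dominate the offline optimum\<close>

lemma levels_in_val_set:
  assumes "set vs \<subseteq> val_set m r"
  shows "L vs i \<in> val_set m r"
  using assms
proof (induction vs arbitrary: i rule: rev_induct)
  case Nil
  then show ?case using r0 by (auto simp: val_set_def image_iff intro!: bexI [of _ 0])
next
  case (snoc v vs)
  then show ?case by (auto simp: vt_levels_snoc update_level_def Let_def max_def)
qed

text \<open>
  A chosen unit has minimal level, hence level at most \<open>\<theta>\<close>: overwriting it loses no excess over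
  \<open>\<theta>\<close>.
\<close>

lemma levels_sum_excess:
  assumes "i \<in> {1..k}" "L vs i \<le> \<theta>" "0 \<le> \<theta>"
  shows "(\<Sum>v\<leftarrow>vs. max 0 (v - \<theta>)) = (\<Sum>i=1..k. max 0 (L vs i - \<theta>))"
  using assms(1,2)
proof (induction vs arbitrary: i rule: rev_induct)
  case Nil
  then show ?case using assms(3) by simp
next
  case (snoc v vs)
  let ?u = "unit vs"
  \<comment> \<open>Levels never decrease, so the same \<open>i\<close> witnesses the hypothesis for
    the prefix.\<close>
  have "L vs i \<le> L (vs @ [v]) i"
    by (simp add: vt_levels_snoc update_level_def Let_def)
  then have *: "L vs i \<le> \<theta>" using snoc.prems by simp
  then have u: "?u \<in> {1..k}" "L vs ?u \<le> \<theta>" using istar_in istar_le [OF snoc.prems(1), of "L vs"] by auto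
  have "(\<Sum>i=1..k. max 0 (L (vs @ [v]) i - \<theta>)) =
      max 0 (v - \<theta>) + (\<Sum>i\<in>{1..k} - {?u}. max 0 (L vs i - \<theta>))"
    using u by (subst sum.remove [of _ ?u])
      (auto simp: vt_levels_snoc update_level_def Let_def max_def intro!: sum.cong)
  moreover have "(\<Sum>i=1..k. max 0 (L vs i - \<theta>)) = (\<Sum>i\<in>{1..k} - {?u}. max 0 (L vs i - \<theta>))"
    using u by (subst sum.remove [of _ ?u]) auto
  ultimately show ?case using snoc.IH [OF snoc.prems(1) *] by simp
qed

text \<open>Take the minimal level as threshold: every level then equals \<open>\<theta>\<close>
  plus its excess, so the threshold bound is exactly the sum of the levels.\<close>

lemma opt_le_sum_levels:
  assumes "set vs \<subseteq> val_set m r"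
  shows "opt k vs \<le> (\<Sum>i=1..k. L vs i)"
proof -
  define \<theta> where "\<theta> = L vs (unit vs)"
  have \<theta>: "0 \<le> \<theta>"
    using levels_in_val_set [OF assms, of "unit vs"] r_nonneg by (auto simp: \<theta>_def val_set_def)
  have "opt k vs \<le> real k * \<theta> + (\<Sum>v\<leftarrow>vs. max 0 (v - \<theta>))"
    by (rule opt_le_threshold [OF \<theta>])
  also have "\<dots> = real k * \<theta> + (\<Sum>i=1..k. L vs i - \<theta>)"
    using istar_le [of _ "L vs"]
    by (subst levels_sum_excess [OF istar_in _ \<theta>]) (auto simp: \<theta>_def intro!: sum.cong)
  also have "\<dots> = (\<Sum>i=1..k. L vs i)"
    by (simp add: sum_subtractf)
  finally show ?thesis .
qed

section \<open>The price distribution of an unsold unit\<close>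

text \<open>For \<open>l < m\<close> the normaliser is positive, so the weights sum to 1 and
  \<open>embed_pmf\<close> yields a genuine distribution.\<close>

lemma unsold_price_embed:
  assumes "l < m"
  defines "E \<equiv> embed_pmf (\<lambda>j. if j \<in> {l+1..m} then qj r j / (\<Sum>j'=l+1..m. qj r j') else 0)"
  shows "pmf E j = (if j \<in> {l+1..m} then qj r j / tail (r l) else 0)" "set_pmf E = {l+1..m}"
proof -
  let ?f = "\<lambda>j. if j \<in> {l+1..m} then qj r j / tail (r l) else 0"
  have pos: "0 < tail (r l)"
    using assms by (subst tail_r) (auto intro!: sum_pos qj_pos)
  have nn: "0 \<le> ?f j" for j
    using pos qj_pos [of j] by (auto intro!: divide_nonneg_pos)
  have "(\<integral>\<^sup>+j. ennreal (?f j) \<partial>count_space UNIV) = (\<Sum>j\<in>{l+1..m}. ennreal (?f j))"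
    by (rule nn_integral_count_space') auto
  also have "\<dots> = ennreal (\<Sum>j\<in>{l+1..m}. ?f j)"
    by (intro sum_ennreal nn)
  also have "(\<Sum>j\<in>{l+1..m}. ?f j) = (\<Sum>j=l+1..m. qj r j) / tail (r l)"
    by (simp add: sum_divide_distrib)
  also have "\<dots> = 1" using pos assms by (simp add: tail_r)
  finally have 1: "(\<integral>\<^sup>+j. ennreal (?f j) \<partial>count_space UNIV) = 1" by simp
  have E: "E = embed_pmf ?f" unfolding E_def tail_r [OF less_imp_le [OF assms(1)]] ..
  show pmf: "pmf E j = (if j \<in> {l+1..m} then qj r j / tail (r l) else 0)" for j
    unfolding E by (rule pmf_embed_pmf [OF nn 1])
  show "set_pmf E = {l+1..m}"
    using pos qj_pos order.strict_implies_not_eq [OF qj_pos] by (auto simp: set_pmf_eq pmf)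
qed

lemma set_unsold_price: "l < m \<Longrightarrow> set_pmf (unsold_price m r l) = (\<lambda>j. ereal (r j)) ` {l+1..m}"
  unfolding unsold_price_def set_map_pmf by (simp only: unsold_price_embed)

lemma expectation_unsold_price:
  fixes g :: "ereal \<Rightarrow> real"
  assumes "l < m"
  shows "measure_pmf.expectation (unsold_price m r l) g =
    (\<Sum>j=l+1..m. qj r j * g (ereal (r j))) / tail (r l)"
  unfolding unsold_price_def integral_map_pmf
  by (subst integral_measure_pmf_real [of "{l+1..m}"])
    (use assms in \<open>simp_all only: unsold_price_embed sum_divide_distrib, auto simp: mult.commute intro!: sum.cong\<close>)

text \<open>The prices that sell are those with index from \<open>l + 1\<close> to \<open>c\<close>,
  and price times weight telescopes over them. The factor \<open>tail (r l)\<close> is later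
  supplied by the probability that the unit is unsold.\<close>

lemma gain_unsold_price:
  assumes "l < m" "c \<le> m"
  shows "tail (r l) * measure_pmf.expectation (unsold_price m r l) (\<lambda>p. if sale p (r c) then real_of_ereal p else 0)
    = max (r l) (r c) - r l"
proof -
  have pos: "0 < tail (r l)"
    using assms by (subst tail_r) (auto intro!: sum_pos qj_pos)
  have "(\<Sum>j=l+1..m. qj r j * (if sale (ereal (r j)) (r c) then real_of_ereal (ereal (r j)) else 0))
      = (\<Sum>j=l+1..m. if j \<le> c then r j - r (j - 1) else 0)"
    using assms by (intro sum.cong refl) (auto simp: r_le_iff r_mult_qj mult.commute)
  also have "\<dots> = (\<Sum>j=l+1..c. r j - r (j - 1))"
    using assms by (intro sum.mono_neutral_cong_right) auto
  also have "\<dots> = max (r l) (r c) - r l"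
  proof (cases "l \<le> c")
    case True
    then have "(\<Sum>j=l+1..c. r j - r (j - 1)) = r c - r l"
      by (induction c rule: dec_induct) auto
    then show ?thesis using True assms by (simp add: r_le_iff max_def)
  next
    case False
    then show ?thesis using assms by (simp add: max_def r_le_iff)
  qed
  finally show ?thesis using pos by (simp add: expectation_unsold_price [OF assms(1)])
qed

text \<open>Without a sale the drawn index exceeds both \<open>l\<close> and \<open>c\<close>; the
  surviving weights are those of the prices above the updated level.\<close>

lemma no_sale_unsold_price:
  assumes "l < m" "c \<le> m"
  shows "tail (r l) * pmf (map_pmf (\<lambda>p. sale p (r c)) (unsold_price m r l)) False = tail (max (r l) (r c))"
proof -
  have pos: "0 < tail (r l)"
    using assms by (subst tail_r) (auto intro!: sum_pos qj_pos)
  have "pmf (map_pmf (\<lambda>p. sale p (r c)) (unsold_price m r l)) False =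
      measure_pmf.expectation (unsold_price m r l) (\<lambda>p. indicator {p. \<not> sale p (r c)} p)"
    by (simp add: pmf_map vimage_def)
  also have "tail (r l) * \<dots> = (\<Sum>j=l+1..m. qj r j * indicator {p. \<not> sale p (r c)} (ereal (r j)))"
    using pos by (simp only: expectation_unsold_price [OF assms(1)]) simp
  also have "\<dots> = tail (max (r l) (r c))"
    unfolding tail_def using assms
    by (intro sum.mono_neutral_cong_right) (auto simp: indicator_def r_less_iff r_le_iff not_le)
  finally show ?thesis .
qed

section \<open>Inventory and sold units in VT\<close>

lemma vt_run_snoc_offer:
  "vt_run m r k tie (vs @ [v]) = bind_pmf (vt_run m r k tie vs) (\<lambda>s.
     map_pmf (\<lambda>p. \<lparr>level = L (vs @ [v]),
              sold = (if sale p v then (sold s)(unit vs := True) else sold s),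
              prices = prices s @ [p]\<rparr>) (offer vs (sold s (unit vs))))"
  unfolding vt_run_snoc
  by (intro bind_pmf_cong refl)
    (auto simp: vt_step_def Let_def level_vt_run vt_levels_snoc offer_def)

text \<open>A sold unit is only offered at price \<open>\<infinity>\<close>, so every sale marks a
  new unit as sold.\<close>

lemma remaining_vt_run:
  "s \<in> set_pmf (vt_run m r k tie vs) \<Longrightarrow>
     remaining k (prices s) vs = int k - int (card {i \<in> {1..k}. sold s i})"
proof (induction vs arbitrary: s rule: rev_induct)
  case Nil
  then show ?case by (simp add: vt_init_def remaining_def)
next
  case (snoc v vs)
  then obtain s' p where s': "s' \<in> set_pmf (vt_run m r k tie vs)" and p: "p \<in> set_pmf (offer vs (sold s' (unit vs)))"
    and s: "s = \<lparr>level = L (vs @ [v]), sold = (if sale p v then (sold s')(unit vs := True) else sold s'),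
              prices = prices s' @ [p]\<rparr>"
    unfolding vt_run_snoc_offer by auto
  show ?case
  proof (cases "sale p v")
    case True
    then have "\<not> sold s' (unit vs)" using p by (auto simp: offer_def)
    moreover have "{i \<in> {1..k}. sold s i} = insert (unit vs) {i \<in> {1..k}. sold s' i}"
      using True istar_in [of "L vs"] by (auto simp: s)
    ultimately have "card {i \<in> {1..k}. sold s i} = Suc (card {i \<in> {1..k}. sold s' i})" by simp
    then show ?thesis
      using True snoc.IH [OF s'] by (simp add: s remaining_snoc length_prices_vt_run [OF s'])
  next
    case False
    then show ?thesis
      using snoc.IH [OF s'] by (simp add: s remaining_snoc length_prices_vt_run [OF s'])
  qed
qed

text \<open>Induction over customers: units not chosen keep both status and level, and for the
  chosen one the old probability is multiplied by that of no sale, turning the tail at the old level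
  into the tail at the new level.\<close>

lemma pmf_unsold:
  assumes "set vs \<subseteq> val_set m r" "i \<in> {1..k}"
  shows "pmf (map_pmf (\<lambda>s. sold s i) (vt_run m r k tie vs)) False = tail (L vs i) / q"
  using assms(1)
proof (induction vs rule: rev_induct)
  case Nil
  then show ?case using q_pos by (simp add: vt_init_def tail_zero)
next
  case (snoc v vs)
  let ?B = "\<lambda>vs. map_pmf (\<lambda>s. sold s i) (vt_run m r k tie vs)"
  have IH: "pmf (?B vs) False = tail (L vs i) / q" using snoc by simp
  show ?case
  proof (cases "i = unit vs")
    case False
    then have "?B (vs @ [v]) = ?B vs"
      unfolding vt_run_snoc_offer map_bind_pmf pmf.map_comp o_def map_pmf_def [of "\<lambda>s. sold s i" "vt_run m r k tie vs"]
      by (intro bind_pmf_cong refl) simp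
    then show ?thesis using IH False by (simp add: vt_levels_snoc update_level_def Let_def)
  next
    case True
    obtain c where c: "c \<le> m" "v = r c" using snoc.prems by (auto simp: val_set_def)
    obtain l where l: "l \<le> m" "L vs i = r l"
      using levels_in_val_set [of vs i] snoc.prems by (auto simp: val_set_def)
    have L': "L (vs @ [v]) i = max (r l) (r c)"
      using True c l by (simp add: vt_levels_snoc update_level_def Let_def)
    let ?U = "unsold_price m r l"
    \<comment> \<open>Levels are deterministic, so the status of the chosen unit evolves by itself,
      with "sold" absorbing.\<close>
    have "?B (vs @ [v]) = bind_pmf (?B vs) (\<lambda>b. if b then return_pmf True else map_pmf (\<lambda>p. sale p v) ?U)"
      unfolding vt_run_snoc_offer map_bind_pmf pmf.map_comp o_def bind_map_pmf
    proof (intro bind_pmf_cong refl)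
      fix s
      have "offer vs (sold s i) = (if sold s i then return_pmf \<infinity> else ?U)"
        using l True by (simp add: offer_def level_index_r)
      moreover have "(if sale p v then (sold s)(i := True) else sold s) i \<longleftrightarrow> sale p v \<or> sold s i" for p
        by simp
      ultimately show "map_pmf (\<lambda>p. sold \<lparr>level = L (vs @ [v]),
              sold = (if sale p v then (sold s)(unit vs := True) else sold s),
              prices = prices s @ [p]\<rparr> i) (offer vs (sold s (unit vs))) =
          (if sold s i then return_pmf True else map_pmf (\<lambda>p. sale p v) ?U)"
        unfolding True [symmetric] vt_state.select_convs by simp
    qed
    then have "pmf (?B (vs @ [v])) False = pmf (?B vs) False * pmf (map_pmf (\<lambda>p. sale p v) ?U) False"
      by (simp only: pmf_bind_bool) simp
    also have "\<dots> = tail (max (r l) (r c)) / q"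
    \<comment> \<open>At the top level \<open>unsold_price\<close> is unspecified, but it is
      multiplied by \<open>tail (r m) = 0\<close>.\<close>
    proof (cases "l = m")
      case True
      then have "max (r l) (r c) = r m" using c by (simp add: max_def r_le_iff)
      moreover have "tail (r m) = 0" by (simp add: tail_r)
      ultimately show ?thesis unfolding IH l(2) True by simp
    next
      case False
      then have "l < m" using l(1) by simp
      from no_sale_unsold_price [OF this c(1)] show ?thesis
        unfolding IH l(2) c(2) times_divide_eq_left by simp
    qed
    finally show ?thesis unfolding L' .
  qed
qed

section \<open>Transfer of laws from VT to \<open>VT'\<close>\<close>

lemma VT'_offer:
  "VT' m r k tie ps vs = bind_pmf (bernoulli_pmf (vt_gamma m r k tie vs (remaining k ps vs))) (offer vs)"
  unfolding VT'_def Let_def offer_def ..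

text \<open>\<open>VT'\<close> uses past prices only through the inventory, and given the inventory
  its coin has the conditional law of the status in VT. Keeping the inventory paired with the price
  is what lets the induction continue.\<close>

lemma inventory_price_law:
  assumes "map_pmf (\<lambda>ps. remaining k ps vs) (run_prices (VT' m r k tie) vs (length vs)) =
    map_pmf (\<lambda>s. remaining k (prices s) vs) (vt_run m r k tie vs)"
  shows "bind_pmf (run_prices (VT' m r k tie) vs (length vs))
      (\<lambda>ps. map_pmf (Pair (remaining k ps vs)) (VT' m r k tie ps vs)) =
    bind_pmf (vt_run m r k tie vs)
      (\<lambda>s. map_pmf (Pair (remaining k (prices s) vs)) (offer vs (sold s (unit vs))))"
    (is "?lhs = ?rhs")
proof -
  let ?R = "run_prices (VT' m r k tie) vs (length vs)" and ?V = "vt_run m r k tie vs"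
  let ?g = "\<lambda>n. bernoulli_pmf (vt_gamma m r k tie vs n)"
  have "?lhs = bind_pmf (map_pmf (\<lambda>ps. remaining k ps vs) ?R)
      (\<lambda>n. bind_pmf (?g n) (\<lambda>b. map_pmf (Pair n) (offer vs b)))"
    unfolding VT'_offer map_bind_pmf bind_map_pmf ..
  also have "\<dots> = bind_pmf (bind_pmf (map_pmf (\<lambda>s. remaining k (prices s) vs) ?V) (\<lambda>n. map_pmf (Pair n) (?g n)))
      (\<lambda>(n, b). map_pmf (Pair n) (offer vs b))"
    unfolding assms bind_assoc_pmf bind_map_pmf prod.case ..
  also have "bind_pmf (map_pmf (\<lambda>s. remaining k (prices s) vs) ?V) (\<lambda>n. map_pmf (Pair n) (?g n)) =
      map_pmf (\<lambda>s. (remaining k (prices s) vs, sold s (unit vs))) ?V"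
    unfolding vt_gamma_def by (rule bind_pmf_cond_bernoulli [symmetric])
  finally show ?thesis unfolding bind_map_pmf prod.case .
qed

text \<open>The next inventory is a function \<open>?h\<close> of the current inventory and the
  price, so equality of the pair laws propagates.\<close>

lemma inventory_law:
  "map_pmf (\<lambda>ps. remaining k ps vs) (run_prices (VT' m r k tie) vs (length vs)) =
    map_pmf (\<lambda>s. remaining k (prices s) vs) (vt_run m r k tie vs)"
proof (induction vs rule: rev_induct)
  case Nil
  then show ?case by (simp add: vt_init_def)
next
  case (snoc v vs)
  let ?h = "\<lambda>(n, p). n - of_bool (sale p v) :: int"
  have "map_pmf (\<lambda>ps. remaining k ps (vs @ [v])) (run_prices (VT' m r k tie) (vs @ [v]) (length (vs @ [v]))) =
    map_pmf ?h (bind_pmf (run_prices (VT' m r k tie) vs (length vs))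
      (\<lambda>ps. map_pmf (Pair (remaining k ps vs)) (VT' m r k tie ps vs)))"
    unfolding run_prices_snoc map_bind_pmf pmf.map_comp o_def
    by (intro bind_pmf_cong refl) (simp add: remaining_snoc length_run_prices)
  also have "\<dots> = map_pmf ?h (bind_pmf (vt_run m r k tie vs)
      (\<lambda>s. map_pmf (Pair (remaining k (prices s) vs)) (offer vs (sold s (unit vs)))))"
    by (simp only: inventory_price_law [OF snoc])
  also have "\<dots> = map_pmf (\<lambda>s. remaining k (prices s) (vs @ [v])) (vt_run m r k tie (vs @ [v]))"
    unfolding vt_run_snoc_offer map_bind_pmf pmf.map_comp o_def
    by (intro bind_pmf_cong refl) (simp add: remaining_snoc length_prices_vt_run)
  finally show ?case .
qed

lemma price_law:
  "bind_pmf (run_prices (VT' m r k tie) vs (length vs)) (\<lambda>ps. VT' m r k tie ps vs) =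
    bind_pmf (map_pmf (\<lambda>s. sold s (unit vs)) (vt_run m r k tie vs)) (offer vs)"
  using arg_cong [OF inventory_price_law [OF inventory_law], of "map_pmf snd" vs]
  by (simp add: map_bind_pmf pmf.map_comp o_def bind_map_pmf)

section \<open>\<open>VT'\<close> respects the constraints on online algorithms\<close>

text \<open>No price exceeds \<open>r m\<close>, so the tail there is empty and the unit is unsold
  with probability 0.\<close>

lemma sold_if_top_level:
  assumes "set vs \<subseteq> val_set m r" "L vs (unit vs) = r m" "s \<in> set_pmf (vt_run m r k tie vs)"
  shows "sold s (unit vs)"
proof -
  have "pmf (map_pmf (\<lambda>s. sold s (unit vs)) (vt_run m r k tie vs)) False = 0"
    unfolding pmf_unsold [OF assms(1) istar_in] assms(2) by (simp add: tail_r)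
  then have "False \<notin> (\<lambda>s. sold s (unit vs)) ` set_pmf (vt_run m r k tie vs)"
    by (simp add: pmf_eq_0_set_pmf)
  then show ?thesis using assms(3) by (auto simp: image_iff)
qed

lemma sold_if_no_inventory:
  assumes "remaining k (prices s) vs \<le> 0" "s \<in> set_pmf (vt_run m r k tie vs)" "i \<in> {1..k}"
  shows "sold s i"
proof -
  have "card {1..k} \<le> card {i \<in> {1..k}. sold s i}"
    using assms by (simp add: remaining_vt_run)
  then have "{i \<in> {1..k}. sold s i} = {1..k}"
    by (intro card_seteq) auto
  then show ?thesis using assms(3) by blast
qed

text \<open>An inventory reached by \<open>VT'\<close> has positive probability under VT by
  \<open>inventory_law\<close>; hence the conditional probability is a true quotient and not
  \<open>0 / 0\<close>.\<close>

lemma vt_gamma_eq_1: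
  assumes "ps \<in> set_pmf (run_prices (VT' m r k tie) vs (length vs))"
    and sold: "\<And>s. s \<in> set_pmf (vt_run m r k tie vs) \<Longrightarrow> remaining k (prices s) vs = remaining k ps vs
      \<Longrightarrow> sold s (unit vs)"
  shows "vt_gamma m r k tie vs (remaining k ps vs) = 1"
proof -
  let ?V = "vt_run m r k tie vs" and ?n = "remaining k ps vs"
  have "?n \<in> set_pmf (map_pmf (\<lambda>ps. remaining k ps vs) (run_prices (VT' m r k tie) vs (length vs)))"
    using assms(1) by simp
  then obtain s where "s \<in> set_pmf ?V" "remaining k (prices s) vs = ?n"
    unfolding inventory_law by auto
  then have "measure ?V {s. remaining k (prices s) vs = ?n} \<noteq> 0"
    by (auto simp: measure_pmf_zero_iff)
  moreover have "measure ?V {s. sold s (unit vs) \<and> remaining k (prices s) vs = ?n} =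
      measure ?V {s. remaining k (prices s) vs = ?n}"
    using sold by (intro measure_pmf.finite_measure_eq_AE) (auto simp: AE_measure_pmf_iff)
  ultimately show ?thesis by (simp add: vt_gamma_def cond_prob_def)
qed

text \<open>At the top level or with empty inventory the coin is surely true and the offer is
  \<open>\<infinity>\<close>. Otherwise \<open>l < m\<close> and all finite offers come from a
  well-defined \<open>unsold_price\<close>.\<close>

lemma online_VT': "online_algorithm m r k (VT' m r k tie)"
  unfolding online_algorithm_def
proof (intro allI impI)
  fix vs ps p
  assume vs: "set vs \<subseteq> val_set m r" and ps: "ps \<in> set_pmf (run_prices (VT' m r k tie) vs (length vs))"
    and p: "p \<in> set_pmf (VT' m r k tie ps vs)"
  obtain l where l: "l \<le> m" "L vs (unit vs) = r l"
    using levels_in_val_set [OF vs, of "unit vs"] by (auto simp: val_set_def)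
  show "p \<in> price_set m r \<and> (remaining k ps vs \<le> 0 \<longrightarrow> p = \<infinity>)"
  proof (cases "l = m \<or> remaining k ps vs \<le> 0")
    case True
    have "vt_gamma m r k tie vs (remaining k ps vs) = 1"
    proof (rule vt_gamma_eq_1 [OF ps])
      fix s
      assume s: "s \<in> set_pmf (vt_run m r k tie vs)" and n: "remaining k (prices s) vs = remaining k ps vs"
      show "sold s (unit vs)"
        using True
      proof
        assume "l = m"
        then show ?thesis using l sold_if_top_level [OF vs _ s] by simp
      next
        assume "remaining k ps vs \<le> 0"
        then show ?thesis using n by (intro sold_if_no_inventory [OF _ s istar_in]) simp
      qed
    qed
    moreover have "bernoulli_pmf 1 = return_pmf True"
      by (rule pmf_eqI) (case_tac i; simp)
    ultimately have "p = \<infinity>" using p by (simp add: VT'_offer bind_return_pmf offer_def)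
    then show ?thesis by (simp add: price_set_def)
  next
    case False
    then show ?thesis
      using p l by (auto simp: VT'_offer offer_def level_index_r set_unsold_price price_set_def split: if_splits)
  qed
qed

section \<open>Expected revenue of \<open>VT'\<close>\<close>

text \<open>Only the unsold branch earns; its probability \<open>tail (r l) / q\<close> cancels the
  normaliser of the price distribution.\<close>

lemma expected_gain:
  assumes vs: "set vs \<subseteq> val_set m r" and v: "v \<in> val_set m r"
  shows "measure_pmf.expectation (bind_pmf (map_pmf (\<lambda>s. sold s (unit vs)) (vt_run m r k tie vs)) (offer vs))
      (\<lambda>p. if sale p v then real_of_ereal p else 0) =
    (max (L vs (unit vs)) v - L vs (unit vs)) / q"
proof -
  let ?g = "\<lambda>p. if sale p v then real_of_ereal p else 0"
  define B where "B = map_pmf (\<lambda>s. sold s (unit vs)) (vt_run m r k tie vs)"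
  obtain c where c: "c \<le> m" "v = r c" using v by (auto simp: val_set_def)
  obtain l where l: "l \<le> m" "L vs (unit vs) = r l"
    using levels_in_val_set [OF vs, of "unit vs"] by (auto simp: val_set_def)
  have B: "pmf B False = tail (r l) / q"
    using pmf_unsold [OF vs istar_in, of "L vs"] l by (simp add: B_def)
  have "measure_pmf.expectation (bind_pmf B (offer vs)) ?g = (max (r l) (r c) - r l) / q"
  \<comment> \<open>For \<open>l = m\<close> the unspecified \<open>unsold_price\<close> is not
    known to have finite support, so the branch is removed by showing that the unit is surely
    sold.\<close>
  proof (cases "l = m")
    case True
    then have "False \<notin> set_pmf B" using B by (simp add: tail_r set_pmf_iff)
    then have "set_pmf B \<subseteq> {True}" by (metis (full_types) insertI1 subsetI)
    then have "B = return_pmf True" by (simp add: set_pmf_subset_singleton)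
    moreover have "max (r l) (r c) = r l" using True c by (simp add: max_def r_le_iff)
    ultimately show ?thesis by (simp add: bind_return_pmf offer_def)
  next
    case False
    then have fin: "finite (set_pmf (offer vs b))" for b
      using l by (simp add: offer_def level_index_r set_unsold_price)
    have "measure_pmf.expectation (bind_pmf B (offer vs)) ?g =
        pmf B False * measure_pmf.expectation (unsold_price m r l) ?g"
      using l by (simp add: pmf_expectation_bind [OF finite fin subset_UNIV] UNIV_bool)
        (simp add: offer_def level_index_r)
    then show ?thesis using gain_unsold_price [of l c] False c l B by simp
  qed
  then show ?thesis by (simp add: B_def c l)
qed

text \<open>A customer changes only the level of the chosen unit, and the expected gain is that
  increase divided by \<open>q\<close>.\<close>

lemma expected_alg_VT':
  assumes "set vs \<subseteq> val_set m r"
  shows "expected_alg (VT' m r k tie) vs = (\<Sum>i=1..k. L vs i) / q"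
  using assms
proof (induction vs rule: rev_induct)
  case Nil
  then show ?case by (simp add: expected_alg_def revenue_def)
next
  case (snoc v vs)
  let ?u = "unit vs"
  have "(\<Sum>i=1..k. L (vs @ [v]) i) = (\<Sum>i=1..k. L vs i) + (max (L vs ?u) v - L vs ?u)"
    using istar_in [of "L vs"]
    by (subst (1 2) sum.remove [of _ ?u])
      (auto simp: vt_levels_snoc update_level_def Let_def intro!: sum.cong)
  moreover have vs: "set vs \<subseteq> val_set m r" and v: "v \<in> val_set m r" using snoc.prems by auto
  ultimately show ?case
    unfolding expected_alg_snoc [OF online_VT' vs v] price_law expected_gain [OF vs v] snoc.IH [OF vs]
    by (simp only: add_divide_distrib)
qed

end

theorem theorem2:
  fixes m k :: nat and r :: "nat \<Rightarrow> real" and tie :: "nat set \<Rightarrow> nat"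
  assumes "m \<ge> 1" and "k \<ge> 1"
    and "r 0 = 0" and "strict_mono_on {0..m} r"
    and "tie_breaking k tie"
  shows "online_algorithm m r k (VT' m r k tie) \<and>
         competitive m r k (c_star m r) (VT' m r k tie)"
proof -
  interpret vt_pricing m k r tie using assms by unfold_locales
  have "c_star m r * opt k vs \<le> expected_alg (VT' m r k tie) vs" if "set vs \<subseteq> val_set m r" for vs
    using opt_le_sum_levels [OF that] q_pos
    by (simp add: c_star_def expected_alg_VT' [OF that] divide_right_mono)
  then show ?thesis using online_VT' by (simp add: competitive_def)
qed

end
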